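(* Let $T$ be a positive integer and $\theta\in\Delta_T$. Let $\{x_t,p_t\}_{t=1}^T$, with $x_t\in X$ and $p_t=(p_t^1,\dots,p_t^m)\in\mathcal{P}$, be the (random) sequence generated by stochastic first-order methods $\mathcal{A}_x$ and $\mathcal{A}_p^i$, $i\in[m]$, according to the update rules $$x_{t+1}=\mathcal{A}_x(\{x_s,p_s\}_{s=1}^t)\in X,\qquad p_{t+1}^i=\mathcal{A}_p^i(\{x_s,p_s\}_{s=1}^t)\in\mathcal{P}^i\quad\forall i\in[m].$$ Suppose that $\mathcal{A}_x$ and $\mathcal{A}_p^i$ satisfy high-probability convergence up to precision $\bar\epsilon\ge 0$, i.e. there exist an increasing and sublinear function $w:\mathbb{R}_+\to\mathbb{R}_+$ and decreasing functions $\mathcal{R}_x(T)$, $\mathcal{R}_p^i(T)$ such that, for all $\Omega\geq 0$ and all $i\in[m]$, $$\mathbb{P}\big(\epsilon^{\bullet}>w(\Omega)\mathcal{R}_x(T)+\bar\epsilon\big)\le 2\exp(-\Omega),\qquad \mathbb{P}\big(\epsilon^{i}>w(\Omega)\mathcal{R}_p^i(T)\big)\le 2\exp(-\Omega).$$ Then, for any $\Omega\ge 0$, $$\mathbb{P}\Big\{\epsilon^{\bullet}+\epsilon^{\circ}\le w(\Omega)\Big(\mathcal{R}_x(T)+\max_{i\in[m]}\mathcal{R}_p^i(T)\Big)+\bar\epsilon\Big\}\ge 1-4m\exp(-\Omega).$$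
   Context: Setting: $[m]=\{1,\dots,m\}$; $\Delta_k=\{q\in\mathbb{R}_+^k:\sum_r q^{(r)}=1\}$. $X\subseteq\mathbb{R}^d$ is closed and convex. For each $i\in[m]$, $F_r^i:X\to\mathbb{R}$, $r\in[n]$, are convex functions that are $G$-Lipschitz and satisfy $|F_r^i(x)|\le M^i$ for all $x\in X$; $\mathbf{F}^i(x)=(F_1^i(x),\dots,F_n^i(x))$. $\mathcal{P}^i\subseteq\Delta_n$ is convex and compact, $\mathcal{P}=\mathcal{P}^1\times\cdots\times\mathcal{P}^m$, and $\phi(x,p)=\max_{i\in[m]}(p^i)^\top\mathbf{F}^i(x)$. Error terms for $\{x_t,p_t,\theta_t\}_{t=1}^T$: $$\epsilon^{\bullet}=\sum_{t=1}^T\theta_t\phi(x_t,p_t)-\inf_{x\in X}\sum_{t=1}^T\theta_t\phi(x,p_t),$$ $$\epsilon^{i}=\sup_{p^i\in\mathcal{P}^i}\sum_{t=1}^T\theta_t(p^i)^\top\mathbf{F}^i(x_t)-\sum_{t=1}^T\theta_t(p_t^i)^\top\mathbf{F}^i(x_t),\qquad \epsilon^{\circ}=\max_{i\in[m]}\epsilon^i.$$ *)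

theory Defs
  imports "HOL-Probability.Probability" "HOL-Library.Landau_Symbols"
begin

definition prob_simplex :: "'k set \<Rightarrow> ('k \<Rightarrow> real) set" where
  "prob_simplex K = {q. (\<forall>r\<in>K. 0 \<le> q r) \<and> (\<Sum>r\<in>K. q r) = 1}"

text \<open>
  The finite index types 'd, 'n and 'm stand for the dimension of the space containing the
  decision set, for [n] and for [m]. The value F i r x is F^i_r(x), and a point p of the product
  of the sets P^i is a vector of vectors with i-th block p $ i.
\<close>

definition F_vec :: "('m \<Rightarrow> 'n::finite \<Rightarrow> real^'d \<Rightarrow> real) \<Rightarrow> 'm \<Rightarrow> real^'d \<Rightarrow> real^'n" where
  "F_vec F i x = (\<chi> r. F i r x)"

definition phi ::
  "('m::finite \<Rightarrow> 'n::finite \<Rightarrow> real^'d \<Rightarrow> real) \<Rightarrow> real^'d \<Rightarrow> real^'n^'m \<Rightarrow> real" where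
  "phi F x p = (MAX i\<in>UNIV. p $ i \<bullet> F_vec F i x)"

text \<open>
  The infimum and suprema below are taken in the reals. They are genuine (nonempty and bounded)
  as soon as the iterates lie in their sets, the functions F i r are bounded on X, and each P i
  is compact.
\<close>

definition eps_bullet ::
  "(real^'d) set \<Rightarrow> ('m::finite \<Rightarrow> 'n::finite \<Rightarrow> real^'d \<Rightarrow> real) \<Rightarrow> nat \<Rightarrow> (nat \<Rightarrow> real) \<Rightarrow>
    (nat \<Rightarrow> real^'d) \<Rightarrow> (nat \<Rightarrow> real^'n^'m) \<Rightarrow> real" where
  "eps_bullet X F T \<theta> x p =
     (\<Sum>t=1..T. \<theta> t * phi F (x t) (p t)) - (INF y\<in>X. \<Sum>t=1..T. \<theta> t * phi F y (p t))"

definition eps_comp ::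
  "('m::finite \<Rightarrow> (real^'n) set) \<Rightarrow> ('m \<Rightarrow> 'n::finite \<Rightarrow> real^'d \<Rightarrow> real) \<Rightarrow> nat \<Rightarrow> (nat \<Rightarrow> real) \<Rightarrow>
    (nat \<Rightarrow> real^'d) \<Rightarrow> (nat \<Rightarrow> real^'n^'m) \<Rightarrow> 'm \<Rightarrow> real" where
  "eps_comp P F T \<theta> x p i =
     (SUP q\<in>P i. \<Sum>t=1..T. \<theta> t * (q \<bullet> F_vec F i (x t)))
     - (\<Sum>t=1..T. \<theta> t * (p t $ i \<bullet> F_vec F i (x t)))"

definition eps_circ ::
  "('m::finite \<Rightarrow> (real^'n) set) \<Rightarrow> ('m \<Rightarrow> 'n::finite \<Rightarrow> real^'d \<Rightarrow> real) \<Rightarrow> nat \<Rightarrow> (nat \<Rightarrow> real) \<Rightarrow>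
    (nat \<Rightarrow> real^'d) \<Rightarrow> (nat \<Rightarrow> real^'n^'m) \<Rightarrow> real" where
  "eps_circ P F T \<theta> x p = (MAX i\<in>UNIV. eps_comp P F T \<theta> x p i)"

definition history ::
  "(nat \<Rightarrow> real^'d) \<Rightarrow> (nat \<Rightarrow> real^'n^'m) \<Rightarrow> nat \<Rightarrow> ((real^'d) \<times> (real^'n^'m)) list" where
  "history x p t = map (\<lambda>s. (x s, p s)) [1..<Suc t]"

text \<open>
  A stochastic method maps the history of iterates and a random sample to the next iterate.
  The sample of round t (for instance the stochastic first-order information drawn in that
  round) is \<xi> t \<omega>. It is shared by all the methods, which covers separate sources of randomness
  by letting it be a tuple. Nothing is assumed on its distribution, nor any independence between
  rounds. The iterates of round 1 are arbitrary random points of the feasible sets.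
\<close>

definition generated_by ::
  "'w measure \<Rightarrow> 's measure \<Rightarrow> (real^'d) set \<Rightarrow> ('m::finite \<Rightarrow> (real^'n) set) \<Rightarrow>
    (((real^'d) \<times> (real^'n^'m)) list \<Rightarrow> 's \<Rightarrow> real^'d) \<Rightarrow>
    ('m \<Rightarrow> ((real^'d) \<times> (real^'n^'m)) list \<Rightarrow> 's \<Rightarrow> real^'n) \<Rightarrow>
    (nat \<Rightarrow> 'w \<Rightarrow> 's) \<Rightarrow> nat \<Rightarrow> (nat \<Rightarrow> 'w \<Rightarrow> real^'d) \<Rightarrow> (nat \<Rightarrow> 'w \<Rightarrow> real^'n^'m) \<Rightarrow> bool" where
  "generated_by M S X P A\<^sub>x A\<^sub>p \<xi> T x p \<longleftrightarrow>
     (\<forall>t\<in>{1..T}. \<xi> t \<in> M \<rightarrow>\<^sub>M S \<and> x t \<in> borel_measurable M \<and> p t \<in> borel_measurable M) \<and>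
     (\<forall>\<omega>\<in>space M. \<forall>t\<in>{1..T}. x t \<omega> \<in> X \<and> (\<forall>i. p t \<omega> $ i \<in> P i)) \<and>
     (\<forall>\<omega>\<in>space M. \<forall>t\<in>{1..<T}.
        x (Suc t) \<omega> = A\<^sub>x (history (\<lambda>s. x s \<omega>) (\<lambda>s. p s \<omega>) t) (\<xi> t \<omega>) \<and>
        (\<forall>i. p (Suc t) \<omega> $ i = A\<^sub>p i (history (\<lambda>s. x s \<omega>) (\<lambda>s. p s \<omega>) t) (\<xi> t \<omega>)))"

text \<open>
  Sublinear is read as "at most linear growth at infinity". This is the weakest of the usual
  readings: it is implied by w(a) = o(a), by a bound w(a) <= c0 + c1 * a, and, for an increasing
  function, by subadditivity.
\<close>

definition sublinear :: "(real \<Rightarrow> real) \<Rightarrow> bool" where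
  "sublinear w \<longleftrightarrow> w \<in> O[at_top](\<lambda>a. a)"

end

theory Submission
  imports Defs
begin

text \<open>
  The inequality is a union bound. Outside the events where \<open>\<epsilon>\<^bsup>\<bullet>\<^esup>\<close> or one of the \<open>\<epsilon>\<^sup>i\<close>
  exceeds its own threshold, adding the thresholds gives the claimed one: as \<open>w \<Omega> \<ge> 0\<close>, each
  \<open>w \<Omega> * R\<^sub>p i T\<close> is at most \<open>w \<Omega> * (MAX i. R\<^sub>p i T)\<close>, hence so is
  \<open>\<epsilon>\<^sup>\<circ>\<close>, the largest of the \<open>\<epsilon>\<^sup>i\<close>. There are \<open>m + 1\<close> exceptional events, each of probability at most \<open>2 exp (- \<Omega>)\<close>,
  and \<open>2 (m + 1) \<le> 4 m\<close> because \<open>m \<ge> 1\<close>.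

  What takes work is that these events are measurable; the measure of a nonmeasurable set is 0 by
  convention, so the assumed tail bounds would say nothing about it. The error terms contain an
  infimum over \<open>X\<close> and suprema over the sets \<open>P i\<close>, which are uncountable. The objectives are
  continuous in the variable being optimised, so a countable dense subset gives the same value
  (lemma \<open>cSUP_dense_subset\<close>), and countable suprema of measurable functions are measurable.
  The values at the random iterates are measurable because each \<open>F i r\<close>, being Lipschitz, is
  continuous on \<open>X\<close>, and the iterates stay in \<open>X\<close>.
\<close>

section \<open>Suprema and infima of random continuous functions\<close>

lemma upper_bound_dense_subset:
  fixes f :: "'a::metric_space \<Rightarrow> real"
  assumes "D \<subseteq> S" "S \<subseteq> closure D" "continuous_on S f" "\<And>d. d \<in> D \<Longrightarrow> f d \<le> u" "s \<in> S"
  shows "f s \<le> u"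
proof -
  obtain a where a: "\<And>n. a n \<in> D" "a \<longlonglongrightarrow> s"
    using assms(2,5) closure_sequential by blast
  have "(f \<circ> a) \<longlonglongrightarrow> f s"
    using assms(1,3,5) a unfolding continuous_on_sequentially by blast
  then show ?thesis
    by (rule LIMSEQ_le_const2) (use a assms(4) in auto)
qed

lemma cSUP_dense_subset:
  fixes f :: "'a::metric_space \<Rightarrow> real"
  assumes D: "D \<subseteq> S" "S \<subseteq> closure D" and f: "continuous_on S f" "bdd_above (f ` S)"
    and ne: "S \<noteq> {}"
  shows "(SUP s\<in>S. f s) = (SUP d\<in>D. f d)"
proof (rule antisym)
  have "D \<noteq> {}"
    using D ne by auto
  moreover have bdd: "bdd_above (f ` D)"
    using f(2) D(1) by (meson bdd_above_mono image_mono)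
  ultimately show "(SUP d\<in>D. f d) \<le> (SUP s\<in>S. f s)"
    using D(1) f(2) by (intro cSUP_subset_mono) auto
  show "(SUP s\<in>S. f s) \<le> (SUP d\<in>D. f d)"
    using upper_bound_dense_subset[OF D f(1)] cSUP_upper[OF _ bdd] ne
    by (intro cSUP_least) blast+
qed

lemma borel_measurable_SUP_continuous:
  fixes S :: "'a::euclidean_space set" and f :: "'a \<Rightarrow> 'w \<Rightarrow> real"
  assumes ne: "S \<noteq> {}"
    and meas: "\<And>s. s \<in> S \<Longrightarrow> f s \<in> borel_measurable M"
    and cont: "\<And>\<omega>. \<omega> \<in> space M \<Longrightarrow> continuous_on S (\<lambda>s. f s \<omega>)"
    and bdd: "\<And>\<omega>. \<omega> \<in> space M \<Longrightarrow> bdd_above ((\<lambda>s. f s \<omega>) ` S)"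
  shows "(\<lambda>\<omega>. SUP s\<in>S. f s \<omega>) \<in> borel_measurable M"
proof -
  obtain D where D: "countable D" "D \<subseteq> S" "S \<subseteq> closure D"
    using separable by blast
  have "bdd_above ((\<lambda>s. f s \<omega>) ` D)" if "\<omega> \<in> space M" for \<omega>
    using bdd[OF that] image_mono[OF D(2)] by (rule bdd_above_mono)
  then have "(\<lambda>\<omega>. SUP s\<in>D. f s \<omega>) \<in> borel_measurable M"
    using D(2) meas by (intro borel_measurable_cSUP D(1)) auto
  then show ?thesis
    using cSUP_dense_subset[OF D(2,3) cont bdd ne] by (simp cong: measurable_cong)
qed

lemma borel_measurable_INF_continuous:
  fixes S :: "'a::euclidean_space set" and f :: "'a \<Rightarrow> 'w \<Rightarrow> real"
  assumes ne: "S \<noteq> {}"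
    and meas: "\<And>s. s \<in> S \<Longrightarrow> f s \<in> borel_measurable M"
    and cont: "\<And>\<omega>. \<omega> \<in> space M \<Longrightarrow> continuous_on S (\<lambda>s. f s \<omega>)"
    and bdd: "\<And>\<omega>. \<omega> \<in> space M \<Longrightarrow> bdd_below ((\<lambda>s. f s \<omega>) ` S)"
  shows "(\<lambda>\<omega>. INF s\<in>S. f s \<omega>) \<in> borel_measurable M"
proof -
  have "bdd_above ((\<lambda>s. - f s \<omega>) ` S)" if "\<omega> \<in> space M" for \<omega>
    using bdd[OF that] by (simp flip: bdd_above_uminus add: image_image)
  then have "(\<lambda>\<omega>. SUP s\<in>S. - f s \<omega>) \<in> borel_measurable M"
    using assms(1-3)
    by (intro borel_measurable_SUP_continuous borel_measurable_uminus continuous_on_minus) auto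
  then show ?thesis
    by (simp add: Inf_real_def image_image)
qed

lemma continuous_on_Max:
  fixes f :: "'i \<Rightarrow> 'a::topological_space \<Rightarrow> 'b::linorder_topology"
  assumes "finite I" "I \<noteq> {}" "\<And>i. i \<in> I \<Longrightarrow> continuous_on A (f i)"
  shows "continuous_on A (\<lambda>x. MAX i\<in>I. f i x)"
  using assms by (induction rule: finite_ne_induct) (auto intro!: continuous_on_max)

section \<open>Measurability of the error terms\<close>

lemma continuous_on_F_vec:
  assumes "\<And>r. continuous_on X (F i r)"
  shows "continuous_on X (F_vec F i)"
  using assms unfolding F_vec_def by (intro continuous_on_vec_lambda)

lemma continuous_on_phi:
  fixes F :: "'m::finite \<Rightarrow> 'n::finite \<Rightarrow> real^'d \<Rightarrow> real"
  assumes "\<And>i r. continuous_on X (F i r)"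
  shows "continuous_on X (\<lambda>y. phi F y q)"
  using assms unfolding phi_def
  by (intro continuous_on_Max continuous_on_inner continuous_on_const continuous_on_F_vec) auto

text \<open>
  One block of the maximum already bounds it below, and that block is linear in the bounded
  values \<open>F i r y\<close>. For fixed \<open>q\<close> the bound is uniform in \<open>y\<close>, as the infimum over \<open>X\<close> needs.
\<close>

lemma phi_lower_bound:
  fixes F :: "'m::finite \<Rightarrow> 'n::finite \<Rightarrow> real^'d \<Rightarrow> real"
  assumes "\<And>r. \<bar>F i r y\<bar> \<le> b"
  shows "- (\<Sum>r\<in>UNIV. \<bar>q $ i $ r\<bar> * b) \<le> phi F y q"
proof -
  have "\<bar>q $ i $ r * F i r y\<bar> \<le> \<bar>q $ i $ r\<bar> * b" for r
    using assms by (simp add: abs_mult mult_left_mono)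
  then have "- (\<Sum>r\<in>UNIV. \<bar>q $ i $ r\<bar> * b) \<le> (\<Sum>r\<in>UNIV. q $ i $ r * F i r y)"
    unfolding sum_negf[symmetric] by (intro sum_mono) (meson abs_le_D2 minus_le_iff)
  also have "\<dots> = q $ i \<bullet> F_vec F i y"
    by (simp add: inner_vec_def F_vec_def)
  also have "\<dots> \<le> phi F y q"
    unfolding phi_def by (intro Max_ge) auto
  finally show ?thesis .
qed

lemma borel_measurable_continuous_on_compose:
  fixes f :: "'a::topological_space \<Rightarrow> 'b::topological_space"
  assumes "continuous_on X f" "g \<in> borel_measurable M" "g \<in> space M \<rightarrow> X"
  shows "(\<lambda>\<omega>. f (g \<omega>)) \<in> borel_measurable M"
  using measurable_compose[OF measurable_restrict_space2[OF assms(3,2)]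
      borel_measurable_continuous_on_restrict[OF assms(1)]] .

lemma borel_measurable_block_inner:
  fixes q :: "'w \<Rightarrow> real^'n^'m" and v :: "'w \<Rightarrow> real^'n"
  assumes "q \<in> borel_measurable M" "v \<in> borel_measurable M"
  shows "(\<lambda>\<omega>. q \<omega> $ i \<bullet> v \<omega>) \<in> borel_measurable M"
proof -
  have "(\<lambda>\<omega>. q \<omega> $ i) \<in> borel_measurable M"
    by (rule borel_measurable_continuous_on[OF _ assms(1)]) (intro continuous_intros)
  then show ?thesis
    using assms(2) by (rule borel_measurable_inner)
qed

lemma borel_measurable_phi:
  fixes F :: "'m::finite \<Rightarrow> 'n::finite \<Rightarrow> real^'d \<Rightarrow> real"
  assumes "\<And>i r. continuous_on X (F i r)"
    and "x \<in> borel_measurable M" "x \<in> space M \<rightarrow> X" "q \<in> borel_measurable M"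
  shows "(\<lambda>\<omega>. phi F (x \<omega>) (q \<omega>)) \<in> borel_measurable M"
  unfolding phi_def
  by (intro borel_measurable_Max borel_measurable_block_inner assms(4)
      borel_measurable_continuous_on_compose[OF continuous_on_F_vec assms(2,3)] assms(1)) auto

lemma borel_measurable_eps_bullet:
  fixes F :: "'m::finite \<Rightarrow> 'n::finite \<Rightarrow> real^'d \<Rightarrow> real"
  assumes F: "\<And>i r. continuous_on X (F i r)" "\<And>i r y. y \<in> X \<Longrightarrow> \<bar>F i r y\<bar> \<le> B i"
    and "X \<noteq> {}" and \<theta>: "\<And>t. t \<in> {1..T} \<Longrightarrow> 0 \<le> \<theta> t"
    and x: "\<And>t. t \<in> {1..T} \<Longrightarrow> x t \<in> borel_measurable M" "\<And>t. t \<in> {1..T} \<Longrightarrow> x t \<in> space M \<rightarrow> X"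
    and p: "\<And>t. t \<in> {1..T} \<Longrightarrow> p t \<in> borel_measurable M"
  shows "(\<lambda>\<omega>. eps_bullet X F T \<theta> (\<lambda>t. x t \<omega>) (\<lambda>t. p t \<omega>)) \<in> borel_measurable M"
  unfolding eps_bullet_def
proof (intro borel_measurable_diff borel_measurable_INF_continuous \<open>X \<noteq> {}\<close>)
  show "(\<lambda>\<omega>. \<Sum>t = 1..T. \<theta> t * phi F (x t \<omega>) (p t \<omega>)) \<in> borel_measurable M"
    by (intro borel_measurable_sum borel_measurable_times borel_measurable_const
        borel_measurable_phi[OF F(1)] x p)
  show "(\<lambda>\<omega>. \<Sum>t = 1..T. \<theta> t * phi F y (p t \<omega>)) \<in> borel_measurable M" if "y \<in> X" for y
    using that
    by (intro borel_measurable_sum borel_measurable_times borel_measurable_const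
        borel_measurable_phi[OF F(1)] p) auto
  fix \<omega>
  show "continuous_on X (\<lambda>y. \<Sum>t = 1..T. \<theta> t * phi F y (p t \<omega>))"
    by (intro continuous_intros continuous_on_phi F)
  fix i :: 'm
  have "(\<Sum>t = 1..T. \<theta> t * - (\<Sum>r\<in>UNIV. \<bar>p t \<omega> $ i $ r\<bar> * B i))
      \<le> (\<Sum>t = 1..T. \<theta> t * phi F y (p t \<omega>))" if "y \<in> X" for y
    using that by (intro sum_mono mult_left_mono phi_lower_bound F(2) \<theta>)
  then show "bdd_below ((\<lambda>y. \<Sum>t = 1..T. \<theta> t * phi F y (p t \<omega>)) ` X)"
    by (rule bdd_belowI2)
qed

lemma borel_measurable_eps_comp:
  fixes F :: "'m::finite \<Rightarrow> 'n::finite \<Rightarrow> real^'d \<Rightarrow> real"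
  assumes F: "\<And>r. continuous_on X (F i r)"
    and P: "compact (P i)" "P i \<noteq> {}"
    and x: "\<And>t. t \<in> {1..T} \<Longrightarrow> x t \<in> borel_measurable M" "\<And>t. t \<in> {1..T} \<Longrightarrow> x t \<in> space M \<rightarrow> X"
    and p: "\<And>t. t \<in> {1..T} \<Longrightarrow> p t \<in> borel_measurable M"
  shows "(\<lambda>\<omega>. eps_comp P F T \<theta> (\<lambda>t. x t \<omega>) (\<lambda>t. p t \<omega>) i) \<in> borel_measurable M"
  unfolding eps_comp_def
proof (intro borel_measurable_diff borel_measurable_SUP_continuous P(2))
  have Fx: "(\<lambda>\<omega>. F_vec F i (x t \<omega>)) \<in> borel_measurable M" if "t \<in> {1..T}" for t
    by (rule borel_measurable_continuous_on_compose[OF continuous_on_F_vec x[OF that]]) (rule F)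
  show "(\<lambda>\<omega>. \<Sum>t = 1..T. \<theta> t * (p t \<omega> $ i \<bullet> F_vec F i (x t \<omega>))) \<in> borel_measurable M"
    by (intro borel_measurable_sum borel_measurable_times borel_measurable_const
        borel_measurable_block_inner Fx p)
  show "(\<lambda>\<omega>. \<Sum>t = 1..T. \<theta> t * (q \<bullet> F_vec F i (x t \<omega>))) \<in> borel_measurable M" for q
    by (intro borel_measurable_sum borel_measurable_times borel_measurable_const
        borel_measurable_inner Fx)
  fix \<omega>
  show cont: "continuous_on (P i) (\<lambda>q. \<Sum>t = 1..T. \<theta> t * (q \<bullet> F_vec F i (x t \<omega>)))"
    by (intro continuous_intros)
  show "bdd_above ((\<lambda>q. \<Sum>t = 1..T. \<theta> t * (q \<bullet> F_vec F i (x t \<omega>))) ` P i)"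
    by (intro bounded_imp_bdd_above compact_imp_bounded compact_continuous_image cont P(1))
qed

section \<open>The union bound\<close>

text \<open>
  If the sum exceeds \<open>a + c\<close>, then \<open>Y\<close> exceeds \<open>a\<close> or some \<open>Z i\<close> exceeds \<open>c\<close>, hence its own
  threshold \<open>b i\<close>. With \<open>m\<close> indices this gives \<open>m + 1\<close> tail bounds of size \<open>2 \<delta>\<close>, which
  \<open>4 m \<delta>\<close> absorbs.
\<close>

lemma (in prob_space) sum_Max_le_union_bound:
  fixes Y :: "'a \<Rightarrow> real" and Z :: "'i::finite \<Rightarrow> 'a \<Rightarrow> real"
  assumes [measurable]: "Y \<in> borel_measurable M" "\<And>i. Z i \<in> borel_measurable M"
    and Y: "prob {\<omega>\<in>space M. Y \<omega> > a} \<le> 2 * \<delta>"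
    and Z: "\<And>i. prob {\<omega>\<in>space M. Z i \<omega> > b i} \<le> 2 * \<delta>"
    and c: "\<And>i. b i \<le> c"
  shows "prob {\<omega>\<in>space M. Y \<omega> + (MAX i\<in>UNIV. Z i \<omega>) \<le> a + c} \<ge> 1 - 4 * real CARD('i) * \<delta>"
proof -
  let ?good = "{\<omega>\<in>space M. Y \<omega> + (MAX i\<in>UNIV. Z i \<omega>) \<le> a + c}"
  let ?U = "{\<omega>\<in>space M. Y \<omega> > a}" and ?V = "\<lambda>i. {\<omega>\<in>space M. Z i \<omega> > b i}"
  have [measurable]: "(\<lambda>\<omega>. MAX i\<in>UNIV. Z i \<omega>) \<in> borel_measurable M"
    by (intro borel_measurable_Max) auto
  have sets: "?good \<in> events" "?U \<in> events" "\<And>i. ?V i \<in> events" "(\<Union>i. ?V i) \<in> events"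
    by measurable
  have "space M - ?good \<subseteq> ?U \<union> (\<Union>i. ?V i)"
  proof (rule subsetI, rule ccontr)
    fix \<omega> assume \<omega>: "\<omega> \<in> space M - ?good" "\<omega> \<notin> ?U \<union> (\<Union>i. ?V i)"
    then have "Y \<omega> \<le> a" "\<And>i. Z i \<omega> \<le> b i"
      by (auto simp: not_less)
    then have "(MAX i\<in>UNIV. Z i \<omega>) \<le> c"
      using c by (auto intro: order_trans)
    with \<open>Y \<omega> \<le> a\<close> \<omega>(1) show False
      by auto
  qed
  then have "prob (space M - ?good) \<le> prob (?U \<union> (\<Union>i. ?V i))"
    using sets by (intro finite_measure_mono) auto
  also have "\<dots> \<le> prob ?U + prob (\<Union>i. ?V i)"
    using sets by (intro measure_Un_le) auto
  also have "\<dots> \<le> 2 * \<delta> + (\<Sum>i::'i\<in>UNIV. 2 * \<delta>)"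
  proof (intro add_mono Y)
    have "prob (\<Union>i. ?V i) \<le> (\<Sum>i\<in>UNIV. prob (?V i))"
      using sets(3) by (intro finite_measure_subadditive_finite) auto
    also have "\<dots> \<le> (\<Sum>i::'i\<in>UNIV. 2 * \<delta>)"
      by (intro sum_mono Z)
    finally show "prob (\<Union>i. ?V i) \<le> (\<Sum>i::'i\<in>UNIV. 2 * \<delta>)" .
  qed
  also have "\<dots> \<le> 4 * real CARD('i) * \<delta>"
  proof -
    have "0 \<le> \<delta>"
      using order_trans[OF measure_nonneg Y] by simp
    moreover have "1 \<le> real CARD('i)"
      using zero_less_card_finite[where 'a='i] by linarith
    ultimately have "1 * \<delta> \<le> real CARD('i) * \<delta>"
      by (intro mult_right_mono)
    then show ?thesis
      by (simp add: algebra_simps)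
  qed
  finally show ?thesis
    using prob_compl[OF sets(1)] by simp
qed

theorem theorem2:
  fixes M :: "'w measure" and S :: "'s measure"
    and X :: "(real^'d) set"
    and F :: "'m::finite \<Rightarrow> 'n::finite \<Rightarrow> real^'d \<Rightarrow> real"
    and G :: real and B :: "'m \<Rightarrow> real"
    and P :: "'m \<Rightarrow> (real^'n) set"
    and T :: nat and \<theta> :: "nat \<Rightarrow> real"
    and A\<^sub>x :: "((real^'d) \<times> (real^'n^'m)) list \<Rightarrow> 's \<Rightarrow> real^'d"
    and A\<^sub>p :: "'m \<Rightarrow> ((real^'d) \<times> (real^'n^'m)) list \<Rightarrow> 's \<Rightarrow> real^'n"
    and \<xi> :: "nat \<Rightarrow> 'w \<Rightarrow> 's"
    and x :: "nat \<Rightarrow> 'w \<Rightarrow> real^'d" and p :: "nat \<Rightarrow> 'w \<Rightarrow> real^'n^'m"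
    and \<epsilon> :: real and w :: "real \<Rightarrow> real"
    and R\<^sub>x :: "nat \<Rightarrow> real" and R\<^sub>p :: "'m \<Rightarrow> nat \<Rightarrow> real"
  assumes "prob_space M"
    and "closed X" and "convex X"
    and "\<And>i r. convex_on X (F i r)"
    and "\<And>i r. G-lipschitz_on X (F i r)"
    and "\<And>i r y. y \<in> X \<Longrightarrow> \<bar>F i r y\<bar> \<le> B i"
    and "\<And>i q. q \<in> P i \<Longrightarrow> vec_nth q \<in> prob_simplex UNIV"
    and "\<And>i. convex (P i)" and "\<And>i. compact (P i)"
    and "T \<ge> 1" and "\<theta> \<in> prob_simplex {1..T}"
    and "generated_by M S X P A\<^sub>x A\<^sub>p \<xi> T x p"
    and "\<epsilon> \<ge> 0"
    and "\<And>\<Omega>. \<Omega> \<ge> 0 \<Longrightarrow> w \<Omega> \<ge> 0" and "mono_on {0..} w" and "sublinear w"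
    and "antimono_on {1..} R\<^sub>x" and "\<And>i. antimono_on {1..} (R\<^sub>p i)"
    and "\<And>\<Omega>. \<Omega> \<ge> 0 \<Longrightarrow>
      measure M {\<omega>\<in>space M. eps_bullet X F T \<theta> (\<lambda>t. x t \<omega>) (\<lambda>t. p t \<omega>) > w \<Omega> * R\<^sub>x T + \<epsilon>}
        \<le> 2 * exp (- \<Omega>)"
    and "\<And>\<Omega> i. \<Omega> \<ge> 0 \<Longrightarrow>
      measure M {\<omega>\<in>space M. eps_comp P F T \<theta> (\<lambda>t. x t \<omega>) (\<lambda>t. p t \<omega>) i > w \<Omega> * R\<^sub>p i T}
        \<le> 2 * exp (- \<Omega>)"
  shows "\<forall>\<Omega>\<ge>0.
    measure M {\<omega>\<in>space M.
        eps_bullet X F T \<theta> (\<lambda>t. x t \<omega>) (\<lambda>t. p t \<omega>) + eps_circ P F T \<theta> (\<lambda>t. x t \<omega>) (\<lambda>t. p t \<omega>)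
          \<le> w \<Omega> * (R\<^sub>x T + (MAX i\<in>UNIV. R\<^sub>p i T)) + \<epsilon>}
      \<ge> 1 - 4 * real CARD('m) * exp (- \<Omega>)"
proof (intro allI impI)
  fix \<Omega> :: real assume \<Omega>: "\<Omega> \<ge> 0"
  interpret prob_space M by fact
  note gen = \<open>generated_by M S X P A\<^sub>x A\<^sub>p \<xi> T x p\<close>[unfolded generated_by_def]
  have meas: "x t \<in> borel_measurable M" "p t \<in> borel_measurable M" "x t \<in> space M \<rightarrow> X"
    if "t \<in> {1..T}" for t
    using gen that by auto
  have F: "continuous_on X (F i r)" for i r
    using \<open>\<And>i r. G-lipschitz_on X (F i r)\<close> by (rule lipschitz_on_continuous_on)
  \<comment> \<open>The optima over the feasible sets are genuine because a first iterate exists: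
    a probability space has a sample point, and there is at least one round.\<close>
  have ne: "X \<noteq> {}" "P i \<noteq> {}" for i
    using gen not_empty \<open>T \<ge> 1\<close> by fastforce+
  have \<theta>: "0 \<le> \<theta> t" if "t \<in> {1..T}" for t
    using \<open>\<theta> \<in> prob_simplex {1..T}\<close> that by (simp add: prob_simplex_def)
  have bullet: "(\<lambda>\<omega>. eps_bullet X F T \<theta> (\<lambda>t. x t \<omega>) (\<lambda>t. p t \<omega>)) \<in> borel_measurable M"
    by (rule borel_measurable_eps_bullet[where B=B]) (use F assms(6) ne \<theta> meas in auto)
  have comp: "(\<lambda>\<omega>. eps_comp P F T \<theta> (\<lambda>t. x t \<omega>) (\<lambda>t. p t \<omega>) i) \<in> borel_measurable M" for i
    by (rule borel_measurable_eps_comp[where X=X]) (use F assms(9) ne meas in auto)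
  have R: "w \<Omega> * R\<^sub>p i T \<le> w \<Omega> * (MAX i\<in>UNIV. R\<^sub>p i T)" for i
    using assms(14)[OF \<Omega>] by (intro mult_left_mono Max_ge) auto
  show "measure M {\<omega>\<in>space M.
        eps_bullet X F T \<theta> (\<lambda>t. x t \<omega>) (\<lambda>t. p t \<omega>) + eps_circ P F T \<theta> (\<lambda>t. x t \<omega>) (\<lambda>t. p t \<omega>)
          \<le> w \<Omega> * (R\<^sub>x T + (MAX i\<in>UNIV. R\<^sub>p i T)) + \<epsilon>}
      \<ge> 1 - 4 * real CARD('m) * exp (- \<Omega>)"
    using sum_Max_le_union_bound[OF bullet comp assms(19)[OF \<Omega>] assms(20)[OF \<Omega>] R]
    by (simp add: eps_circ_def algebra_simps)
qed

end
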